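(* Let $f(x)=\tfrac12x'Qx+q'x$ be convex quadratic, let $0<\gamma<1/L_f$, let $\lambda_k=\lambda=(1-\gamma L_f)/(1+\gamma L_f)$ for all $k$, and let $$\beta_k=\begin{cases}0&\text{if }k=0,\\ \tfrac{k-1}{k+2}&\text{if }k>0.\end{cases}$$ Let $u^0=x^0\in\mathbb{R}^n$ and let the sequences be generated, for $k\ge0$, by $$y^k=\mathrm{prox}_{\gamma f}(u^k),\quad z^k=\mathrm{prox}_{\gamma g}(2y^k-u^k),\quad x^{k+1}=u^k+\lambda_k(z^k-y^k),\quad u^{k+1}=x^{k+1}+\beta_k(x^{k+1}-x^k).$$ Then for every $\tilde x\in\tilde X$ and every $k\ge0$, $$F(z^k)-F_\star\le\frac{2}{\gamma\lambda(k+2)^2}\|x^0-\tilde x\|^2.$$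
   Context: $Q\in\mathbb{R}^{n\times n}$ is symmetric positive semidefinite, $q\in\mathbb{R}^n$, $L_f=\lambda_{\max}(Q)$. Let $g:\mathbb{R}^n\to\mathbb{R}\cup\{+\infty\}$ be proper, closed and convex. Put $F=f+g$, assume that the set of minimizers of $F$ is nonempty, and let $F_\star=\min F$. For $\gamma>0$ and a proper closed convex function $h$, $\mathrm{prox}_{\gamma h}(x)=\arg\min_z\{h(z)+\tfrac{1}{2\gamma}\|z-x\|^2\}$. The set $\tilde X$ is the set of $x\in\mathbb{R}^n$ with $\mathrm{prox}_{\gamma g}(2\,\mathrm{prox}_{\gamma f}(x)-x)=\mathrm{prox}_{\gamma f}(x)$; the minimizers of $F$ are exactly the points $\mathrm{prox}_{\gamma f}(\tilde x)$, $\tilde x\in\tilde X$. Convention: $1/L_f=+\infty$ if $L_f=0$. *)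

theory Defs
  imports "HOL-Analysis.Analysis"
begin

definition symmetric_psd :: "real^'n^'n \<Rightarrow> bool" where
  "symmetric_psd Q \<longleftrightarrow> transpose Q = Q \<and> (\<forall>x. 0 \<le> x \<bullet> (Q *v x))"

definition eigenvalues :: "real^'n^'n \<Rightarrow> real set" where
  "eigenvalues Q = {l. \<exists>v. v \<noteq> 0 \<and> Q *v v = l *\<^sub>R v}"

text \<open>Only used for symmetric matrices, whose set of real eigenvalues is finite and nonempty.\<close>

definition lambda_max :: "real^'n^'n \<Rightarrow> real" where
  "lambda_max Q = Max (eigenvalues Q)"

definition quad :: "real^'n^'n \<Rightarrow> real^'n \<Rightarrow> real^'n \<Rightarrow> real" where
  "quad Q q x = 1/2 * (x \<bullet> (Q *v x)) + q \<bullet> x"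

text \<open>Functions with values in the reals extended by \<open>+\<infinity>\<close> are rendered as \<open>ereal\<close>-valued
  functions; properness excludes the value \<open>-\<infinity>\<close>. As usual for extended-valued functions,
  closedness and convexity are those of the epigraph, a subset of the product with the
  (finite) reals.\<close>

definition epi :: "('a \<Rightarrow> ereal) \<Rightarrow> ('a \<times> real) set" where
  "epi h = {(x, r). h x \<le> ereal r}"

definition proper_fun :: "('a \<Rightarrow> ereal) \<Rightarrow> bool" where
  "proper_fun h \<longleftrightarrow> (\<forall>x. h x \<noteq> -\<infinity>) \<and> (\<exists>x. h x \<noteq> \<infinity>)"

definition closed_fun :: "('a::real_normed_vector \<Rightarrow> ereal) \<Rightarrow> bool" where
  "closed_fun h \<longleftrightarrow> closed (epi h)"

definition convex_fun :: "('a::real_normed_vector \<Rightarrow> ereal) \<Rightarrow> bool" where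
  "convex_fun h \<longleftrightarrow> convex (epi h)"

definition minimizers :: "('a \<Rightarrow> ereal) \<Rightarrow> 'a set" where
  "minimizers h = {x. \<forall>y. h x \<le> h y}"

text \<open>For \<open>\<gamma> > 0\<close> and proper closed convex \<open>h\<close> the minimizer exists and is unique, so the choice
  made by \<open>ARG_MIN\<close> is immaterial.\<close>

definition prox :: "real \<Rightarrow> ('a::real_normed_vector \<Rightarrow> ereal) \<Rightarrow> 'a \<Rightarrow> 'a" where
  "prox \<gamma> h x = (ARG_MIN (\<lambda>z. h z + ereal (1 / (2 * \<gamma>) * (norm (z - x))\<^sup>2)) z. True)"

definition dr_fixpoints ::
    "real \<Rightarrow> ('a::real_normed_vector \<Rightarrow> ereal) \<Rightarrow> ('a \<Rightarrow> ereal) \<Rightarrow> 'a set" where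
  "dr_fixpoints \<gamma> f g = {x. prox \<gamma> g (2 *\<^sub>R prox \<gamma> f x - x) = prox \<gamma> f x}"

end

theory Submission
  imports Defs
begin

text \<open>In the metric of the form of \<open>(1 - \<gamma> Q) (1 + \<gamma> Q)\<close>, the Douglas--Rachford iteration for a quadratic
  \<open>f\<close> is a proximal point method for \<open>F = f + g\<close>, up to a remainder. The map \<open>prox \<gamma> f\<close> is affine, so
  the whole scheme may be written in terms of \<open>X\<^sub>k = prox\<^sub>\<gamma>\<^sub>f(x\<^sup>k)\<close>, and with the displacement
  \<open>h\<^sub>k = y\<^sup>k - X\<^sub>k\<^sub>+\<^sub>1\<close> the optimality conditions of the two proximal steps combine to
  \<open>\<gamma> \<lambda> (F(z\<^sup>k) - F(v)) \<le> \<langle>h\<^sub>k, z\<^sup>k - v\<rangle>\<close> for all \<open>v\<close> (\<open>dr_step_inequality\<close>), the product being that of the metric, where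
  \<open>z\<^sup>k = X\<^sub>k\<^sub>+\<^sub>1 - C h\<^sub>k\<close>. The operator \<open>C = (1 + \<gamma> Q) / \<lambda> - 1\<close> is nonnegative and self-adjoint in that
  metric, so the sum \<open>\<delta>\<^sub>k\<close> of \<open>\<gamma> \<lambda> (F(z\<^sup>k) - F\<^sub>\<star>)\<close> and \<open>\<langle>h\<^sub>k, C h\<^sub>k\<rangle> / 2\<close> obeys the two
  inequalities of an accelerated proximal point method with iterates \<open>X\<^sub>k\<close>. As \<open>\<delta>\<^sub>k\<close> dominates the gap at \<open>z\<^sup>k\<close>
  and the metric is bounded by the distance between the corresponding \<open>x\<close>, everything reduces to the rate
  \<open>2 / (k + 2)\<^sup>2\<close> of that method (\<open>accelerated_proximal_point_rate\<close>).

  The momentum \<open>\<beta>\<^sub>k = (k - 1) / (k + 2)\<close> lags one step behind the classical choice \<open>k / (k + 3)\<close>, for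
  which the usual estimate sequence would give this rate; for \<open>\<beta>\<^sub>k\<close> it gives only
  \<open>2 / (k + 1)\<^sup>2\<close>. A proximal step, however, dissipates more than a gradient step. This excess pays for
  an additional quartic weight on the gap, scaled to the horizon \<open>K\<close>, which raises the final weight
  from \<open>(K + 1) (K + 2) / 4\<close> to \<open>(K + 2)\<^sup>2 / 4\<close> (\<open>potential_step\<close>, \<open>potential_final\<close>).\<close>

section \<open>Accelerated proximal point iterations in a semi-inner product\<close>

text \<open>The metric in which the method is a proximal point method is given by a positive semidefinite
  bilinear form that is not the inner product of the space.\<close>

locale semi_inner =
  fixes ip :: "'a::real_vector \<Rightarrow> 'a \<Rightarrow> real"
  assumes bilin: "bilinear ip"
    and sym: "ip a b = ip b a"
    and psd: "0 \<le> ip a a"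
begin

lemmas expand = bilinear_ladd[OF bilin] bilinear_radd[OF bilin]
  bilinear_lsub[OF bilin] bilinear_rsub[OF bilin]
  bilinear_lmul[OF bilin] bilinear_rmul[OF bilin]
  bilinear_lneg[OF bilin] bilinear_rneg[OF bilin]

lemma binary_form_nonneg:
  assumes "0 < A" "0 \<le> C" "B\<^sup>2 \<le> 4 * A * C"
  shows "0 \<le> A * ip a a + B * ip a c + C * ip c c"
proof -
  have "0 \<le> ip ((2*A) *\<^sub>R a + B *\<^sub>R c) ((2*A) *\<^sub>R a + B *\<^sub>R c)"
    by (rule psd)
  also have "\<dots> = 4*A*(A * ip a a + B * ip a c) + B\<^sup>2 * ip c c"
    by (simp add: expand sym[of c a] algebra_simps power2_eq_square)
  also have "\<dots> \<le> 4*A*(A * ip a a + B * ip a c) + 4*A*C * ip c c"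
    using assms(3) psd by (simp add: mult_right_mono)
  also have "\<dots> = 4*A*(A * ip a a + B * ip a c + C * ip c c)"
    by (simp add: algebra_simps)
  finally show ?thesis using assms(1) by (simp add: zero_le_mult_iff)
qed

end

text \<open>The form whose discriminant this is appears as the dissipation of one accelerated step. The
  difference of the two sides, as a function of \<open>e\<close>, is concave on the unit interval and positive at
  both ends.\<close>

lemma discriminant_bound:
  fixes k e :: real
  assumes k: "2 \<le> k" and e: "0 \<le> e" "e \<le> 1"
  shows "((k + 2) * (k - 2 + e) / 4)\<^sup>2 \<le> 4 * (k\<^sup>2 / 8) * ((k\<^sup>2 + 3 + 2 * e * (k + 1)) / 8)"
proof -
  have id: "k\<^sup>2 * (k\<^sup>2 + 3 + 2 * e * (k + 1)) - ((k + 2) * (k - 2 + e))\<^sup>2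
      = (1 - e) * (11 * k\<^sup>2 - 16) + e * (8 * k\<^sup>2 + 4 * k - 4) + e * (1 - e) * (k + 2)\<^sup>2"
    by (simp add: power2_eq_square algebra_simps)
  have "4 \<le> k\<^sup>2" using power_mono[OF k, of 2] by simp
  then have "0 \<le> (1 - e) * (11 * k\<^sup>2 - 16) + e * (8 * k\<^sup>2 + 4 * k - 4) + e * (1 - e) * (k + 2)\<^sup>2"
    using k e by (intro add_nonneg_nonneg mult_nonneg_nonneg) auto
  with id have "((k + 2) * (k - 2 + e))\<^sup>2 \<le> k\<^sup>2 * (k\<^sup>2 + 3 + 2 * e * (k + 1))" by linarith
  then show ?thesis by (simp add: power_divide)
qed

text \<open>With \<open>b = 0\<close> the increments of the weight are \<open>(k + 1) / 2\<close>, exactly what the extrapolated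
  point pays for. The correction adds \<open>b (k + 1) k (k - 1)\<close> to the increment at \<open>k\<close>. This is the
  solution of \<open>c\<^sub>k (k - 2) = c\<^sub>k\<^sub>-\<^sub>1 (k + 1)\<close>, the recursion for which the cross terms in
  \<open>potential\<close> below telescope along the momentum \<open>(k - 2) / (k + 1)\<close> without leaving any square of
  the distance.\<close>

definition weight :: "real \<Rightarrow> real \<Rightarrow> real" where
  "weight b k = k * (k + 1) * (1 + b * (k - 1) * (k - 2)) / 4"

context semi_inner
begin

text \<open>The first term is the usual squared distance of the extrapolated point
  \<open>p + (k - 2) / 2 d\<close>, which the momentum \<open>(k - 2) / (k + 1)\<close> moves by \<open>- (k + 1) / 2\<close> times the
  gradient. The cross term pays for the additional weight of the gap, and the last term is fed by the
  dissipation of the method.\<close>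

definition potential :: "real \<Rightarrow> real \<Rightarrow> 'a \<Rightarrow> 'a \<Rightarrow> real" where
  "potential b k p d =
     ip (p + ((k - 2) / 2) *\<^sub>R d) (p + ((k - 2) / 2) *\<^sub>R d) / 2
     + b * k * (k - 1) * (k - 2) * ip p d + (k - 1) / 2 * ip d d"

text \<open>The inequality for \<open>p'\<close> is taken with the increment of the weight, the one for \<open>d'\<close> with the
  weight itself. All terms in \<open>p'\<close> then cancel, and the decrease of the potential is a quadratic form in \<open>d\<close> and \<open>d'\<close>
  that is nonnegative by \<open>discriminant_bound\<close>.\<close>

lemma potential_step:
  fixes b k \<delta> \<delta>' :: real
  assumes k: "2 \<le> k" and b: "0 \<le> b" "b * k * (k - 1) * (k - 2) \<le> 1"
    and g: "g = ((k - 2) / (k + 1)) *\<^sub>R d - d'"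
    and p': "p' = p + d'"
    and opt: "\<delta>' \<le> ip g p'"
    and desc: "\<delta>' - \<delta> \<le> ip g d'"
  shows "weight b (k + 1) * \<delta>' + potential b (k + 1) p' d'
    \<le> weight b k * \<delta> + potential b k p d"
proof -
  define e where "e = b * k * (k - 1) * (k - 2)"
  have e: "0 \<le> e" "e \<le> 1" using k b by (auto simp: e_def)
  have W: "0 \<le> weight b k" using k b by (simp add: weight_def)
  have inc: "weight b (k + 1) - weight b k = (k + 1) / 2 + b * (k + 1) * k * (k - 1)"
    by (simp add: weight_def field_simps)
  then have inc0: "0 \<le> weight b (k + 1) - weight b k" using k b by simp
  have "weight b (k + 1) * \<delta>' - weight b k * \<delta>
      = (weight b (k + 1) - weight b k) * \<delta>' + weight b k * (\<delta>' - \<delta>)"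
    by (simp add: algebra_simps)
  also have "\<dots> \<le> (weight b (k + 1) - weight b k) * ip g p' + weight b k * ip g d'"
    using inc0 W opt desc by (intro add_mono mult_left_mono)
  finally have *: "weight b (k + 1) * \<delta>' - weight b k * \<delta> \<le>
     (weight b (k + 1) - weight b k) * ip g p' + weight b k * ip g d'" .
  have form: "0 \<le> k\<^sup>2/8 * ip d d + (- ((k+2)*(k-2+e)/4)) * ip d d' + (k\<^sup>2+3+2*e*(k+1))/8 * ip d' d'"
    using k e discriminant_bound[OF k e] by (intro binary_form_nonneg) auto
  have p: "p = p' - d'" by (simp add: p')
  have g1: "ip g x = ((k - 2) / (k + 1)) * ip d x - ip d' x" for x
    unfolding g by (simp add: expand)
  have nz: "k + 1 \<noteq> 0" using k by simp
  define c where "c = (k - 2) / (k + 1)"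
  have c: "(k + 1) * c = k - 2" using nz by (simp add: c_def)
  have "(weight b (k + 1) - weight b k) * ip g p'
     = ((k + 1) * c) * (1/2 + b*k*(k-1)) * ip d p' - ((k+1)/2 + b*(k+1)*k*(k-1)) * ip d' p'"
    unfolding inc g1 c_def[symmetric] by (simp add: algebra_simps add_divide_distrib)
  then have i1: "(weight b (k + 1) - weight b k) * ip g p'
     = ((k-2)/2 + e) * ip d p' - ((k+1)/2 + b*(k+1)*k*(k-1)) * ip d' p'"
    unfolding c e_def by (simp add: algebra_simps diff_divide_distrib)
  have "weight b k * ip g d' =
       (1 + b*(k-1)*(k-2)) * k * (((k + 1) * c) * ip d d' - (k+1) * ip d' d') / 4"
    unfolding g1 c_def[symmetric] weight_def by (simp add: algebra_simps)
  then have i2: "weight b k * ip g d' =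
       (1 + b*(k-1)*(k-2)) * k * ((k-2) * ip d d' - (k+1) * ip d' d') / 4"
    unfolding c .
  have "potential b k p d - potential b (k + 1) p' d'
      - ((weight b (k + 1) - weight b k) * ip g p' + weight b k * ip g d')
      = k\<^sup>2/8 * ip d d + (- ((k+2)*(k-2+e)/4)) * ip d d' + (k\<^sup>2+3+2*e*(k+1))/8 * ip d' d'"
    unfolding i1 i2 potential_def p e_def
    by (simp add: expand sym[of p' d] sym[of p' d'] sym[of d' d] field_simps power2_eq_square)
  with form * show ?thesis by linarith
qed

text \<open>When the coefficient of the cross term has grown to one, the whole potential is a perfect square.
  This value of \<open>b\<close> is also the one that brings the weight to the required size.\<close>

lemma potential_final:
  assumes b: "b * k * (k - 1) * (k - 2) = 1"
  shows "0 \<le> potential b k p d"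
proof -
  have "potential b k p d =
    ip (p + (k / 2) *\<^sub>R d) (p + (k / 2) *\<^sub>R d) / 2"
    unfolding potential_def b
    by (simp add: expand sym[of d p] field_simps)
  then show ?thesis using psd[of "p + (k / 2) *\<^sub>R d"] by linarith
qed

text \<open>Here \<open>Y k - X (Suc k)\<close> plays the gradient at step \<open>k\<close> and \<open>\<delta> k\<close> the gap of the objective at
  \<open>X (Suc k)\<close>; the last two hypotheses are the subgradient inequality of a proximal point step, tested
  against \<open>w\<close> and against the previous iterate.

  The weight must reach \<open>(k + 2)\<^sup>2 / 4\<close> at the last step, while the weight \<open>j (j + 1) / 4\<close> that
  suits this momentum ends at \<open>(k + 1) (k + 2) / 4\<close>. The parameter \<open>b\<close> closes this gap, of
  relative size \<open>1 / (k + 1)\<close>, and so must depend on the horizon \<open>k\<close>. For \<open>k < 2\<close> there is no such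
  \<open>b\<close> and the bound is checked by hand.\<close>

lemma accelerated_proximal_point_rate:
  fixes X Y :: "nat \<Rightarrow> 'a" and \<delta> :: "nat \<Rightarrow> real"
  assumes Y0: "Y 0 = X 0"
    and Y: "\<And>k. Y (Suc k) = X (Suc k) +
      (if k = 0 then 0 else (real k - 1) / (real k + 2)) *\<^sub>R (X (Suc k) - X k)"
    and nonneg: "\<And>k. 0 \<le> \<delta> k"
    and opt: "\<And>k. \<delta> k \<le> ip (Y k - X (Suc k)) (X (Suc k) - w)"
    and desc: "\<And>k. \<delta> (Suc k) - \<delta> k
      \<le> ip (Y (Suc k) - X (Suc (Suc k))) (X (Suc (Suc k)) - X (Suc k))"
  shows "\<delta> k \<le> 2 / (real k + 2)\<^sup>2 * ip (X 0 - w) (X 0 - w)"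
proof -
  define p where "p k = X k - w" for k
  define d where "d k = X (Suc k) - X k" for k
  define R where "R = ip (p 0) (p 0)"
  have p_Suc: "p (Suc k) = p k + d k" for k by (simp add: p_def d_def)
  have opt0: "\<delta> 0 \<le> - ip (d 0) (p 1)"
    using opt[of 0] by (simp add: Y0 p_def d_def expand)
  have opt1: "\<delta> 1 \<le> - ip (d 1) (p 2)" and desc1: "\<delta> 1 - \<delta> 0 \<le> - ip (d 1) (d 1)"
    using opt[of 1] desc[of 0] Y[of 0] by (simp_all add: p_def d_def expand numeral_2_eq_2)
  have p1: "p 1 = p 0 + d 0" and p2: "p 2 = p 1 + d 1"
    using p_Suc[of 0] p_Suc[of 1] by (simp_all add: numeral_2_eq_2)
  \<comment> \<open>The first two steps carry no momentum: two plain proximal steps, of which the quadratic gains are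
    kept as the initial value of the potential.\<close>
  have two: "3 / 2 * \<delta> 1 + ip (p 2) (p 2) / 2 + ip (d 1) (d 1) \<le> R / 2"
  proof -
    have a: "p 0 = p 1 - d 0" "p 1 = p 2 - d 1" using p1 p2 by simp_all
    have square: "ip (x - y) (x - y) = ip x x - 2 * ip y x + ip y y" for x y
      by (simp add: expand sym[of x y])
    have n0: "R = ip (p 1) (p 1) - 2 * ip (d 0) (p 1) + ip (d 0) (d 0)"
      unfolding R_def a(1) by (rule square)
    have n1: "ip (p 1) (p 1) = ip (p 2) (p 2) - 2 * ip (d 1) (p 2) + ip (d 1) (d 1)"
      unfolding a(2) by (rule square)
    show ?thesis
      using n0 n1 opt0 opt1 desc1 nonneg[of 0] psd[of "d 0"] by linarith
  qed
  have "(real k + 2)\<^sup>2 * \<delta> k \<le> 2 * R"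
  proof -
    consider "k = 0" | "k = 1" | "2 \<le> k" by linarith
    then show ?thesis
    proof cases
      case 1
      have "0 \<le> 1 / 2 * ip (p 0) (p 0) + 2 * ip (p 0) (d 0) + 2 * ip (d 0) (d 0)"
        by (rule binary_form_nonneg) auto
      then have "- 4 * ip (d 0) (p 1) \<le> 2 * R"
        unfolding p1 R_def by (simp add: expand sym[of "d 0" "p 0"])
          (use psd[of "p 0"] in linarith)
      with 1 opt0 show ?thesis by simp
    next
      case 2
      have "0 \<le> 1 * ip (d 1) (d 1) + 3 / 4 * ip (d 1) (p 2) + 1 / 2 * ip (p 2) (p 2)"
        by (rule binary_form_nonneg) (auto simp: power2_eq_square)
      with two opt1 have "9 * \<delta> 1 \<le> 2 * R" by linarith
      with 2 show ?thesis by simp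
    next
      case 3
      define K where "K = real k"
      \<comment> \<open>chosen so that the cross term has coefficient one at the horizon \<open>K + 1\<close>\<close>
      define b where "b = 1 / (K * (K - 1) * (K + 1))"
      have K: "2 \<le> K" using 3 by (simp add: K_def)
      have bK: "b * (K + 1) * K * (K - 1) = 1" and b0: "0 \<le> b"
        using K by (auto simp: b_def)
      \<comment> \<open>\<open>\<delta> j\<close> belongs to \<open>X (Suc j)\<close>, hence the index \<open>j + 1\<close>\<close>
      define E where "E j = weight b (real j + 1) * \<delta> j
          + potential b (real j + 1) (p (Suc j)) (d j)" for j
      have E1: "E 1 \<le> R / 2"
        using two psd[of "d 1"]
        by (simp add: E_def weight_def potential_def numeral_2_eq_2[symmetric])
      have mono: "E (Suc j) \<le> E j" if "1 \<le> j" "Suc j \<le> k" for j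
      proof -
        define J where "J = real j + 1"
        have J: "2 \<le> J" "J \<le> K" using that by (simp_all add: J_def K_def)
        have "b * (J * (J - 1) * (J - 2)) \<le> b * ((K + 1) * K * (K - 1))"
          using J K b0 by (intro mult_left_mono mult_mono) auto
        then have bJ: "b * J * (J - 1) * (J - 2) \<le> 1" using bK by (simp add: mult.assoc)
        have gg: "Y (Suc j) - X (Suc (Suc j)) = ((J - 2) / (J + 1)) *\<^sub>R d j - d (Suc j)"
          using that Y[of j] by (simp add: d_def J_def algebra_simps)
        have "weight b (J + 1) * \<delta> (Suc j) + potential b (J + 1) (p (Suc (Suc j))) (d (Suc j))
           \<le> weight b J * \<delta> j + potential b J (p (Suc j)) (d j)"
          using potential_step[OF J(1) b0 bJ gg p_Suc[of "Suc j"] ] opt[of "Suc j"] desc[of j]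
          by (simp add: p_def d_def)
        then show ?thesis by (simp add: E_def J_def add.commute add.left_commute)
      qed
      have "E j \<le> R / 2" if "1 \<le> j" "j \<le> k" for j
        using that
      proof (induction j rule: dec_induct)
        case base
        show ?case by (rule E1)
      next
        case (step n)
        then show ?case using mono[of n] by simp
      qed
      then have "E k \<le> R / 2" using 3 by simp
      moreover have "0 \<le> potential b (K + 1) (p (Suc k)) (d k)"
        using bK by (intro potential_final) (simp add: algebra_simps)
      moreover have "weight b (K + 1) = (K + 2)\<^sup>2 / 4"
      proof -
        have "weight b (K + 1) = (K + 2) * ((K + 1) + b * (K + 1) * K * (K - 1)) / 4"
          by (simp add: weight_def algebra_simps)
        then show ?thesis unfolding bK by (simp add: power2_eq_square)
      qed
      ultimately have "(K + 2)\<^sup>2 / 4 * \<delta> k \<le> R / 2"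
        unfolding E_def K_def[symmetric] by simp
      then show ?thesis by (simp add: K_def mult.commute)
    qed
  qed
  then show ?thesis
    by (simp add: R_def p_def field_simps)
qed

end

section \<open>The largest eigenvalue of a symmetric matrix\<close>

lemma symmetric_inner:
  fixes Q :: "real^'n^'n"
  assumes "transpose Q = Q"
  shows "a \<bullet> (Q *v b) = (Q *v a) \<bullet> b"
  by (metis assms dot_lmul_matrix transpose_matrix_vector)

text \<open>A nonnegative quadratic form is minimal where it vanishes, so its gradient vanishes there too. The
  step length \<open>t\<close> below makes the linear term dominate.\<close>

lemma Rayleigh_attained_imp_eigenvector:
  fixes Q :: "real^'n^'n"
  assumes Q: "transpose Q = Q" and m: "\<And>x. 0 \<le> m * (norm x)\<^sup>2 - x \<bullet> (Q *v x)"
    and v: "m * (norm v)\<^sup>2 - v \<bullet> (Q *v v) = 0"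
  shows "Q *v v = m *\<^sub>R v"
proof (rule ccontr)
  assume "Q *v v \<noteq> m *\<^sub>R v"
  define h where "h = m *\<^sub>R v - Q *v v"
  define c where "c = m * (norm h)\<^sup>2 - h \<bullet> (Q *v h)"
  define t where "t = (norm h)\<^sup>2 / (c + 1)"
  have h: "0 < (norm h)\<^sup>2" using \<open>Q *v v \<noteq> m *\<^sub>R v\<close> by (simp add: h_def)
  have c: "0 \<le> c" unfolding c_def by (rule m)
  have t: "0 < t" using h c by (simp add: t_def)
  have hh: "m * (h \<bullet> v) - h \<bullet> (Q *v v) = (norm h)\<^sup>2"
    by (simp add: h_def power2_norm_eq_inner inner_diff_right)
  have "0 \<le> m * (norm (v - t *\<^sub>R h))\<^sup>2 - (v - t *\<^sub>R h) \<bullet> (Q *v (v - t *\<^sub>R h))"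
    by (rule m)
  also have "\<dots> = (m * (norm v)\<^sup>2 - v \<bullet> (Q *v v)) - 2 * t * (m * (h \<bullet> v) - h \<bullet> (Q *v v)) + t\<^sup>2 * c"
    using symmetric_inner[OF Q, of v h] unfolding c_def power2_norm_eq_inner
    by (simp add: matrix_vector_mult_diff_distrib matrix_vector_mult_scaleR
        inner_diff_left inner_diff_right inner_commute[of v h] inner_commute[of "Q *v v" h]
        algebra_simps power2_eq_square)
  also have "\<dots> = t * (t * c - 2 * (norm h)\<^sup>2)"
    unfolding v hh by (simp add: power2_eq_square algebra_simps)
  finally have "2 * (norm h)\<^sup>2 \<le> t * c" using t by (simp add: zero_le_mult_iff)
  moreover have "t * c \<le> (norm h)\<^sup>2"
    using h c by (simp add: t_def field_simps)
  ultimately show False using h by simp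
qed

text \<open>\<open>lambda_max\<close> is a \<open>Max\<close> and hence says something only about a finite set. Eigenvectors of distinct
  eigenvalues are orthogonal, which gives finiteness, and a maximizer of the Rayleigh quotient on the
  compact unit sphere is an eigenvector, which identifies the maximum.\<close>

lemma Rayleigh_le_lambda_max:
  fixes Q :: "real^'n^'n"
  assumes Q: "transpose Q = Q"
  shows "x \<bullet> (Q *v x) \<le> lambda_max Q * (norm x)\<^sup>2"
    and "lambda_max Q \<in> eigenvalues Q"
proof -
  have "continuous_on (sphere (0::real^'n) 1) (\<lambda>x. x \<bullet> (Q *v x))"
    by (intro continuous_intros linear_continuous_on_compose[OF continuous_on_id] ) auto
  moreover have "sphere (0::real^'n) 1 \<noteq> {}" by simp
  ultimately obtain v where v: "norm v = 1"
    and v_max: "\<And>x. norm x = 1 \<Longrightarrow> x \<bullet> (Q *v x) \<le> v \<bullet> (Q *v v)"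
    using continuous_attains_sup[OF compact_sphere, of "0::real^'n" 1 "\<lambda>x. x \<bullet> (Q *v x)"]
    by (auto simp: dist_norm)
  define m where "m = v \<bullet> (Q *v v)"
  have m: "x \<bullet> (Q *v x) \<le> m * (norm x)\<^sup>2" for x
  proof (cases "x = 0")
    case False
    have "(x /\<^sub>R norm x) \<bullet> (Q *v (x /\<^sub>R norm x)) \<le> m"
      unfolding m_def using False by (intro v_max) simp
    then show ?thesis
      using False by (simp add: matrix_vector_mult_scaleR field_simps power2_eq_square)
  qed simp
  have "Q *v v = m *\<^sub>R v"
    using m v by (intro Rayleigh_attained_imp_eigenvector[OF Q]) (auto simp: m_def)
  then have m_ev: "m \<in> eigenvalues Q"
    using v unfolding eigenvalues_def by (auto intro!: exI[of _ v])
  have ev_le: "l \<le> m" if "l \<in> eigenvalues Q" for l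
  proof -
    from that obtain w where w: "w \<noteq> 0" "Q *v w = l *\<^sub>R w" by (auto simp: eigenvalues_def)
    then have "l * (norm w)\<^sup>2 \<le> m * (norm w)\<^sup>2" using m[of w] by (simp add: power2_norm_eq_inner)
    then show ?thesis using w(1) by simp
  qed
  have "finite (eigenvalues Q)"
  proof -
    have "\<forall>l\<in>eigenvalues Q. \<exists>w. w \<noteq> 0 \<and> Q *v w = l *\<^sub>R w" by (auto simp: eigenvalues_def)
    then obtain w where w: "\<And>l. l \<in> eigenvalues Q \<Longrightarrow> w l \<noteq> 0 \<and> Q *v w l = l *\<^sub>R w l"
      by metis
    have orth: "w l \<bullet> w l' = 0" if "l \<in> eigenvalues Q" "l' \<in> eigenvalues Q" "l \<noteq> l'" for l l'
    proof -
      have "l' * (w l \<bullet> w l') = l * (w l \<bullet> w l')"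
        using symmetric_inner[OF Q, of "w l" "w l'"] w[OF that(1)] w[OF that(2)] by simp
      then show ?thesis using that(3) by simp
    qed
    have "inj_on w (eigenvalues Q)"
    proof (rule inj_onI)
      fix l l' assume "l \<in> eigenvalues Q" "l' \<in> eigenvalues Q" "w l = w l'"
      then show "l = l'" using orth[of l l'] w[of l'] by auto
    qed
    moreover have "pairwise orthogonal (w ` eigenvalues Q)"
      using orth by (auto simp: pairwise_def orthogonal_def)
    then have "finite (w ` eigenvalues Q)" by (rule pairwise_orthogonal_imp_finite)
    ultimately show ?thesis using finite_imageD by blast
  qed
  then have "lambda_max Q = m"
    unfolding lambda_max_def using m_ev ev_le by (intro Max_eqI) auto
  then show "x \<bullet> (Q *v x) \<le> lambda_max Q * (norm x)\<^sup>2" "lambda_max Q \<in> eigenvalues Q"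
    using m m_ev by auto
qed

lemma lambda_max_nonneg:
  fixes Q :: "real^'n^'n"
  assumes "symmetric_psd Q"
  shows "0 \<le> lambda_max Q"
proof -
  have "transpose Q = Q" using assms by (simp add: symmetric_psd_def)
  from Rayleigh_le_lambda_max(2)[OF this]
  obtain w where w: "w \<noteq> 0" "Q *v w = lambda_max Q *\<^sub>R w" by (auto simp: eigenvalues_def)
  have "0 \<le> w \<bullet> (Q *v w)" using assms by (simp add: symmetric_psd_def)
  then have "0 \<le> lambda_max Q * (norm w)\<^sup>2" using w by (simp add: power2_norm_eq_inner)
  then show ?thesis using w(1) by (simp add: zero_le_mult_iff)
qed

text \<open>Both rest on \<open>\<gamma> Q\<^sup>2 \<le> Q\<close> in the order of symmetric matrices, which follows from evaluating the
  form of \<open>Q\<close> at \<open>a - \<gamma> Q a\<close>.\<close>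

lemma psd_square_bounds:
  fixes Q :: "real^'n^'n"
  assumes Q: "symmetric_psd Q" and \<gamma>: "0 \<le> \<gamma>" "\<gamma> * lambda_max Q \<le> 1"
  shows "\<gamma>\<^sup>2 * (norm (Q *v a))\<^sup>2 \<le> (norm a)\<^sup>2"
    and "\<gamma>\<^sup>2 * ((Q *v a) \<bullet> (Q *v (Q *v a))) \<le> a \<bullet> (Q *v a)"
proof -
  have sym: "transpose Q = Q" using Q by (simp add: symmetric_psd_def)
  have bound: "\<gamma> * (b \<bullet> (Q *v b)) \<le> (norm b)\<^sup>2" for b
  proof -
    have "\<gamma> * (b \<bullet> (Q *v b)) \<le> \<gamma> * (lambda_max Q * (norm b)\<^sup>2)"
      using \<gamma>(1) Rayleigh_le_lambda_max(1)[OF sym] by (rule mult_left_mono[rotated])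
    also have "\<dots> = \<gamma> * lambda_max Q * (norm b)\<^sup>2" by simp
    also have "\<dots> \<le> 1 * (norm b)\<^sup>2" using \<gamma>(2) by (rule mult_right_mono) simp
    finally show ?thesis by simp
  qed
  define A where "A = (Q *v a) \<bullet> (Q *v (Q *v a))"
  have A: "\<gamma> * A \<le> (norm (Q *v a))\<^sup>2" unfolding A_def by (rule bound)
  have "0 \<le> (a - \<gamma> *\<^sub>R (Q *v a)) \<bullet> (Q *v (a - \<gamma> *\<^sub>R (Q *v a)))"
    using Q by (simp add: symmetric_psd_def)
  also have "\<dots> = a \<bullet> (Q *v a) - 2 * \<gamma> * (norm (Q *v a))\<^sup>2 + \<gamma> * (\<gamma> * A)"
    using symmetric_inner[OF sym, of a "Q *v a"]
    by (simp add: A_def power2_norm_eq_inner matrix_vector_mult_diff_distrib matrix_vector_mult_scaleR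
        inner_diff_left inner_diff_right algebra_simps)
  also have "\<dots> \<le> a \<bullet> (Q *v a) - 2 * \<gamma> * (norm (Q *v a))\<^sup>2 + \<gamma> * (norm (Q *v a))\<^sup>2"
    using A \<gamma>(1) by (intro add_left_mono mult_left_mono)
  finally have 1: "\<gamma> * (norm (Q *v a))\<^sup>2 \<le> a \<bullet> (Q *v a)" by simp
  have "\<gamma>\<^sup>2 * (norm (Q *v a))\<^sup>2 \<le> \<gamma> * (a \<bullet> (Q *v a))"
    using mult_left_mono[OF 1 \<gamma>(1)] by (simp add: power2_eq_square)
  then show "\<gamma>\<^sup>2 * (norm (Q *v a))\<^sup>2 \<le> (norm a)\<^sup>2" using bound[of a] by linarith
  have "\<gamma>\<^sup>2 * A \<le> \<gamma> * (norm (Q *v a))\<^sup>2"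
    using mult_left_mono[OF A \<gamma>(1)] by (simp add: power2_eq_square)
  then show "\<gamma>\<^sup>2 * ((Q *v a) \<bullet> (Q *v (Q *v a))) \<le> a \<bullet> (Q *v a)" using 1 by (simp add: A_def)
qed

section \<open>Proximal points\<close>

lemma prox_eqI:
  assumes "\<And>w. w \<noteq> p \<Longrightarrow> h p + ereal (1 / (2 * \<gamma>) * (norm (p - v))\<^sup>2)
      < h w + ereal (1 / (2 * \<gamma>) * (norm (w - v))\<^sup>2)"
  shows "prox \<gamma> h v = p"
  unfolding prox_def arg_min_def
proof (rule some_equality)
  let ?\<phi> = "\<lambda>w. h w + ereal (1 / (2 * \<gamma>) * (norm (w - v))\<^sup>2)"
  show "is_arg_min ?\<phi> (\<lambda>_. True) p"
  proof -
    have "\<not> ?\<phi> w < ?\<phi> p" for w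
      using assms[of w] by (cases "w = p")
        (simp_all only: order.irrefl not_False_eq_True not_less order.strict_implies_order)
    then show ?thesis by (simp add: is_arg_min_def)
  qed
  show "x = p" if "is_arg_min ?\<phi> (\<lambda>_. True) x" for x
    using assms[of x] that by (auto simp: is_arg_min_def)
qed

lemma prox_quad_eqI:
  fixes Q :: "real^'n^'n"
  assumes Q: "symmetric_psd Q" and \<gamma>: "0 < \<gamma>" and u: "p + \<gamma> *\<^sub>R (Q *v p + q) = u"
  shows "prox \<gamma> (\<lambda>v. ereal (quad Q q v)) u = p"
proof (rule prox_eqI)
  have sym: "transpose Q = Q" and psd: "\<And>x. 0 \<le> x \<bullet> (Q *v x)"
    using Q by (auto simp: symmetric_psd_def)
  fix w assume "w \<noteq> p"
  define e where "e = w - p"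
  have w: "w = p + e" by (simp add: e_def)
  have "0 < (norm e)\<^sup>2 / (2 * \<gamma>)" using \<open>w \<noteq> p\<close> \<gamma> by (simp add: e_def)
  define r where "r = Q *v p + q"
  have pu: "p - u = - (\<gamma> *\<^sub>R r)" "w - u = e - \<gamma> *\<^sub>R r" by (simp_all add: u[symmetric] w r_def)
  have "1 / (2 * \<gamma>) * (norm (w - u))\<^sup>2
      = (norm e)\<^sup>2 / (2 * \<gamma>) - e \<bullet> r + 1 / (2 * \<gamma>) * (norm (p - u))\<^sup>2"
    unfolding pu power2_norm_eq_inner using \<gamma>
    by (simp add: inner_diff_left inner_diff_right inner_commute[of r e]
        field_simps power2_eq_square)
  moreover have "quad Q q w = quad Q q p + e \<bullet> r + e \<bullet> (Q *v e) / 2"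
    using symmetric_inner[OF sym, of p e]
    by (simp add: quad_def w r_def matrix_vector_right_distrib inner_add_left inner_add_right
        inner_commute[of q e] inner_commute[of "Q *v p" e])
  ultimately show "ereal (quad Q q p) + ereal (1 / (2 * \<gamma>) * (norm (p - u))\<^sup>2)
      < ereal (quad Q q w) + ereal (1 / (2 * \<gamma>) * (norm (w - u))\<^sup>2)"
    using psd[of e] \<open>0 < (norm e)\<^sup>2 / (2 * \<gamma>)\<close> by simp
qed

lemma prox_quad:
  fixes Q :: "real^'n^'n"
  assumes Q: "symmetric_psd Q" and \<gamma>: "0 < \<gamma>"
  shows "prox \<gamma> (\<lambda>v. ereal (quad Q q v)) u
    + \<gamma> *\<^sub>R (Q *v prox \<gamma> (\<lambda>v. ereal (quad Q q v)) u + q) = u"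
proof -
  have psd: "\<And>x. 0 \<le> x \<bullet> (Q *v x)"
    using Q by (simp add: symmetric_psd_def)
  let ?T = "\<lambda>p. p + \<gamma> *\<^sub>R (Q *v p)"
  have lin: "linear ?T"
    by (intro linearI)
      (simp_all add: matrix_vector_right_distrib matrix_vector_mult_scaleR algebra_simps)
  have "inj ?T"
  proof (subst linear_injective_0[OF lin], intro allI impI)
    fix p assume "p + \<gamma> *\<^sub>R (Q *v p) = 0"
    then have "p \<bullet> (p + \<gamma> *\<^sub>R (Q *v p)) = 0" by simp
    then have "p \<bullet> p + \<gamma> * (p \<bullet> (Q *v p)) = 0" by (simp add: inner_add_right)
    moreover have "0 \<le> \<gamma> * (p \<bullet> (Q *v p))" using psd \<gamma> by simp
    ultimately show "p = 0" using inner_ge_zero[of p]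
      by (metis add_nonneg_eq_0_iff inner_eq_zero_iff)
  qed
  then have "surj ?T" using linear_injective_imp_surjective[OF lin] by blast
  from surjD[OF this, of "u - \<gamma> *\<^sub>R q"]
  obtain p where p: "u - \<gamma> *\<^sub>R q = p + \<gamma> *\<^sub>R (Q *v p)" ..
  have u: "p + \<gamma> *\<^sub>R (Q *v p + q) = u"
    using p by (simp add: scaleR_right_distrib) (simp add: algebra_simps)
  show ?thesis unfolding prox_quad_eqI[OF Q \<gamma> u] by (rule u)
qed

lemma quadratic_le_linear_imp_bounded:
  fixes n \<alpha> c d :: real
  assumes "0 < \<alpha>" "0 \<le> c" "0 \<le> d" "0 \<le> n" "\<alpha> * n\<^sup>2 \<le> c * n + d"
  shows "n \<le> 1 + (c + d) / \<alpha>"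
proof (cases "n \<le> 1")
  case True
  then show ?thesis using assms by (simp add: add_increasing2)
next
  case False
  then have "d \<le> d * n" using assms by (simp add: mult_le_cancel_left1)
  then have "\<alpha> * n * n \<le> (c + d) * n" using assms by (simp add: power2_eq_square algebra_simps)
  then have "\<alpha> * n \<le> c + d" using False by simp
  then have "n \<le> (c + d) / \<alpha>" using assms by (simp add: field_simps)
  then show ?thesis by simp
qed

text \<open>A minorant with curvature below \<open>1 / \<gamma>\<close> makes the proximal objective coercive. On the epigraph, with
  the value of \<open>h\<close> replaced by the second component, this objective is continuous and its sublevel sets
  are compact, so it attains its minimum.\<close>

lemma prox_is_minimizer:
  fixes h :: "'a::euclidean_space \<Rightarrow> ereal"
  assumes h: "proper_fun h" "closed_fun h" and \<gamma>: "0 < \<gamma>"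
    and minorant: "\<And>z. ereal (m - b * norm z - a * (norm z)\<^sup>2) \<le> h z"
    and b: "0 \<le> b" and a: "0 \<le> a" "2 * \<gamma> * a < 1"
  shows "h (prox \<gamma> h v) + ereal (1 / (2 * \<gamma>) * (norm (prox \<gamma> h v - v))\<^sup>2)
       \<le> h w + ereal (1 / (2 * \<gamma>) * (norm (w - v))\<^sup>2)"
proof -
  let ?\<phi> = "\<lambda>z. h z + ereal (1 / (2 * \<gamma>) * (norm (z - v))\<^sup>2)"
  define \<psi> where "\<psi> = (\<lambda>(z::'a, r::real). r + 1 / (2 * \<gamma>) * (norm (z - v))\<^sup>2)"
  obtain z0 where "h z0 \<noteq> \<infinity>" "h z0 \<noteq> -\<infinity>" using h(1) by (auto simp: proper_fun_def)
  then obtain r0 where r0: "h z0 = ereal r0" by (cases "h z0") auto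
  define C where "C = \<psi> (z0, r0)"
  define S where "S = epi h \<inter> {p. \<psi> p \<le> C}"
  have cont: "continuous_on T \<psi>" for T
    unfolding \<psi>_def case_prod_unfold by (intro continuous_intros)
  have "closed S" unfolding S_def
    using h(2) cont by (intro closed_Int closed_Collect_le) (auto simp: closed_fun_def)
  define \<alpha> where "\<alpha> = 1 / (2 * \<gamma>) - a"
  have \<alpha>: "0 < \<alpha>" using a \<gamma> by (simp add: \<alpha>_def field_simps)
  define R where "R = 1 + (b + norm v / \<gamma> + \<bar>C - m\<bar>) / \<alpha>"
  have bounds: "norm z \<le> R \<and> m - b * R - a * R\<^sup>2 \<le> r \<and> r \<le> C" if "(z, r) \<in> S" for z r
  proof -
    have "h z \<le> ereal r" and le: "r + 1 / (2 * \<gamma>) * (norm (z - v))\<^sup>2 \<le> C"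
      using that by (auto simp: S_def epi_def \<psi>_def)
    then have r: "m - b * norm z - a * (norm z)\<^sup>2 \<le> r"
      using minorant[of z] by (metis ereal_less_eq(3) order_trans)
    have "(norm z - norm v)\<^sup>2 \<le> (norm (z - v))\<^sup>2"
      using norm_triangle_ineq3[of z v] by (simp add: abs_le_square_iff[symmetric])
    then have "1 / (2 * \<gamma>) * (norm z - norm v)\<^sup>2 \<le> 1 / (2 * \<gamma>) * (norm (z - v))\<^sup>2"
      using \<gamma> by (intro mult_left_mono) auto
    moreover have "1 / (2 * \<gamma>) * (norm z - norm v)\<^sup>2
       = (norm z)\<^sup>2 / (2 * \<gamma>) - norm v / \<gamma> * norm z + (norm v)\<^sup>2 / (2 * \<gamma>)"
      using \<gamma> by (simp add: power2_eq_square field_simps)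
    moreover have "0 \<le> (norm v)\<^sup>2 / (2 * \<gamma>)" using \<gamma> by simp
    moreover have "\<alpha> * (norm z)\<^sup>2 = (norm z)\<^sup>2 / (2 * \<gamma>) - a * (norm z)\<^sup>2"
      by (simp add: \<alpha>_def algebra_simps)
    moreover have "(b + norm v / \<gamma>) * norm z = b * norm z + norm v / \<gamma> * norm z"
      by (simp add: algebra_simps)
    ultimately have "\<alpha> * (norm z)\<^sup>2 \<le> (b + norm v / \<gamma>) * norm z + \<bar>C - m\<bar>"
      using r le by linarith
    then have "norm z \<le> R" unfolding R_def
      using \<alpha> b \<gamma> by (intro quadratic_le_linear_imp_bounded) auto
    moreover from this have "b * norm z \<le> b * R" "a * (norm z)\<^sup>2 \<le> a * R\<^sup>2"
      using a b by (auto intro!: mult_left_mono power_mono)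
    moreover have "0 \<le> 1 / (2 * \<gamma>) * (norm (z - v))\<^sup>2" using \<gamma> by simp
    ultimately show ?thesis using r le by linarith
  qed
  have "S \<subseteq> cball 0 R \<times> {m - b * R - a * R\<^sup>2 .. C}"
    using bounds by (auto simp: dist_norm)
  then have "bounded S" by (rule bounded_subset[rotated]) (intro bounded_Times, auto)
  with \<open>closed S\<close> have "compact S" by (simp add: compact_eq_bounded_closed)
  moreover have "(z0, r0) \<in> S" by (simp add: S_def epi_def r0 C_def)
  ultimately obtain z r where zr: "(z, r) \<in> S" and min: "\<And>p. p \<in> S \<Longrightarrow> \<psi> (z, r) \<le> \<psi> p"
    using continuous_attains_inf[OF _ _ cont[of S]] by (metis empty_iff surj_pair)
  have zC: "\<psi> (z, r) \<le> C" and hz: "h z \<le> ereal r" using zr by (auto simp: S_def epi_def)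
  have z_min: "?\<phi> z \<le> ?\<phi> w" for w
  proof -
    have "?\<phi> z \<le> ereal r + ereal (1 / (2 * \<gamma>) * (norm (z - v))\<^sup>2)"
      using hz by (intro add_right_mono)
    also have "\<dots> = ereal (\<psi> (z, r))" by (simp add: \<psi>_def)
    also have "\<dots> \<le> ?\<phi> w"
    proof (cases "h w")
      case (real s)
      show ?thesis
      proof (cases "\<psi> (w, s) \<le> C")
        case True
        then have "(w, s) \<in> S" by (simp add: S_def epi_def real)
        then show ?thesis using min[of "(w, s)"] by (simp add: real \<psi>_def)
      next
        case False
        then show ?thesis using zC by (simp add: real \<psi>_def)
      qed
    next
      case MInf
      then show ?thesis using h(1) by (simp add: proper_fun_def)
    qed simp
    finally show ?thesis .
  qed
  have "is_arg_min ?\<phi> (\<lambda>_. True) (prox \<gamma> h v)"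
    unfolding prox_def arg_min_def
    by (rule someI[of _ z]) (use z_min in \<open>simp add: is_arg_min_def not_less\<close>)
  then show ?thesis by (simp add: is_arg_min_def not_less)
qed

text \<open>Comparing the minimizer with the points of the segment towards \<open>w\<close> costs only a second order term
  in the segment parameter, so the first order term has the right sign.\<close>

lemma prox_minimizer_subgradient:
  fixes h :: "'a::real_inner \<Rightarrow> ereal"
  assumes h: "proper_fun h" "convex_fun h" and \<gamma>: "0 < \<gamma>"
    and min: "\<And>w. h p + ereal (1 / (2 * \<gamma>) * (norm (p - v))\<^sup>2)
       \<le> h w + ereal (1 / (2 * \<gamma>) * (norm (w - v))\<^sup>2)"
  obtains hp where "h p = ereal hp"
    "\<And>w hw. h w = ereal hw \<Longrightarrow> hp + ((v - p) \<bullet> (w - p)) / \<gamma> \<le> hw"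
proof -
  obtain w0 where "h w0 \<noteq> \<infinity>" "h w0 \<noteq> -\<infinity>" using h(1) by (auto simp: proper_fun_def)
  then have "h p \<noteq> \<infinity>" using min[of w0] by (cases "h w0") auto
  moreover have "h p \<noteq> -\<infinity>" using h(1) by (simp add: proper_fun_def)
  ultimately obtain hp where hp: "h p = ereal hp" by (cases "h p") auto
  moreover have "hp + ((v - p) \<bullet> (w - p)) / \<gamma> \<le> hw" if hw: "h w = ereal hw" for w hw
  proof -
    define D where "D = (norm (w - p))\<^sup>2 / (2 * \<gamma>)"
    have D: "0 \<le> D" using \<gamma> by (simp add: D_def)
    define s where "s = hp + ((v - p) \<bullet> (w - p)) / \<gamma> - hw"
    have le: "s \<le> t * D" if t: "0 < t" "t \<le> 1" for t
    proof -
      define c where "c = p + t *\<^sub>R (w - p)"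
      have "(p, hp) \<in> epi h" "(w, hw) \<in> epi h" by (simp_all add: epi_def hp hw)
      then have "(1 - t) *\<^sub>R (p, hp) + t *\<^sub>R (w, hw) \<in> epi h"
        using h(2) t unfolding convex_fun_def by (intro convexD) auto
      then have "h c \<le> ereal ((1 - t) * hp + t * hw)"
        by (simp add: epi_def c_def algebra_simps)
      then have "h c + ereal (1 / (2 * \<gamma>) * (norm (c - v))\<^sup>2)
          \<le> ereal ((1 - t) * hp + t * hw) + ereal (1 / (2 * \<gamma>) * (norm (c - v))\<^sup>2)"
        by (rule add_right_mono)
      from order_trans[OF min[of c] this]
      have "hp + 1 / (2 * \<gamma>) * (norm (p - v))\<^sup>2 \<le> (1 - t) * hp + t * hw + 1 / (2 * \<gamma>) * (norm (c - v))\<^sup>2"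
        by (simp add: hp)
      moreover have "(norm (c - v))\<^sup>2 = (norm (p - v))\<^sup>2 - 2 * t * ((v - p) \<bullet> (w - p)) + t\<^sup>2 * (norm (w - p))\<^sup>2"
      proof -
        have "c - v = t *\<^sub>R (w - p) - (v - p)" "p - v = - (v - p)" by (simp_all add: c_def)
        then show ?thesis
          by (simp only: power2_norm_eq_inner)
            (simp add: inner_diff_left inner_diff_right inner_commute algebra_simps power2_eq_square)
      qed
      then have "1 / (2 * \<gamma>) * (norm (c - v))\<^sup>2 = 1 / (2 * \<gamma>) * (norm (p - v))\<^sup>2
          - t * (((v - p) \<bullet> (w - p)) / \<gamma>) + t * (t * D)"
        using \<gamma> by (simp add: D_def field_simps power2_eq_square)
      ultimately have "t * s \<le> t * (t * D)" by (simp add: s_def algebra_simps)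
      then show ?thesis using t by simp
    qed
    have "s \<le> 0"
    proof (rule ccontr)
      assume "\<not> s \<le> 0"
      then have s: "0 < s" by simp
      define t where "t = min 1 (s / (2 * D + 1))"
      have t: "0 < t" "t \<le> 1" using s D by (simp_all add: t_def)
      have "t * D \<le> s / (2 * D + 1) * D" using D by (intro mult_right_mono) (simp_all add: t_def)
      also have "\<dots> < s" using s D by (auto simp: field_simps intro!: add_pos_nonneg)
      finally show False using le[OF t] by simp
    qed
    then show ?thesis by (simp add: s_def)
  qed
  ultimately show thesis by (rule that)
qed

section \<open>One Douglas--Rachford step\<close>

lemma quad_above_tangent:
  fixes Q :: "real^'n^'n"
  assumes Q: "symmetric_psd Q"
  shows "quad Q q z + (Q *v z + q) \<bullet> (w - z) \<le> quad Q q w"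
proof -
  have sym: "transpose Q = Q" and psd: "0 \<le> (w - z) \<bullet> (Q *v (w - z))"
    using Q by (auto simp: symmetric_psd_def)
  have "quad Q q w - (quad Q q z + (Q *v z + q) \<bullet> (w - z)) = (w - z) \<bullet> (Q *v (w - z)) / 2"
    using symmetric_inner[OF sym, of z w]
    by (simp add: quad_def matrix_vector_mult_diff_distrib inner_diff_left inner_diff_right
        inner_add_left inner_commute[of "Q *v z"] field_simps)
  with psd show ?thesis by simp
qed

lemma quad_upper_bound:
  fixes Q :: "real^'n^'n"
  assumes Q: "symmetric_psd Q"
  shows "quad Q q w \<le> norm q * norm w + lambda_max Q / 2 * (norm w)\<^sup>2"
  using Rayleigh_le_lambda_max(1)[of Q w] norm_cauchy_schwarz[of q w] Q
  by (simp add: quad_def symmetric_psd_def)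

text \<open>The point \<open>2 y - u\<close> is the gradient step \<open>y - \<gamma> \<nabla>f(y)\<close>, so \<open>z\<close> is a forward-backward step from
  \<open>y\<close>. Since \<open>f\<close> is quadratic, replacing its gradient at \<open>y\<close> by the one at \<open>z\<close> is exact, and the
  result is a subgradient of \<open>f + g\<close> at the new point \<open>z\<close> itself. The hypothesis on \<open>m\<close> is that
  \<open>f + g\<close> is bounded below; with \<open>\<gamma> \<lambda>\<^sub>m\<^sub>a\<^sub>x < 1\<close> it makes the proximal problem coercive.\<close>

lemma dr_step_inequality:
  fixes Q :: "real^'n^'n" and g :: "real^'n \<Rightarrow> ereal"
  assumes Q: "symmetric_psd Q" and \<gamma>: "0 < \<gamma>" "\<gamma> * lambda_max Q < 1"
    and g: "proper_fun g" "closed_fun g" "convex_fun g"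
    and bound: "\<And>w. ereal (m - quad Q q w) \<le> g w"
    and y: "y = prox \<gamma> (\<lambda>v. ereal (quad Q q v)) u"
    and z: "z = prox \<gamma> g (2 *\<^sub>R y - u)"
  obtains gz where "g z = ereal gz"
    "\<And>w gw. g w = ereal gw \<Longrightarrow>
      (quad Q q z + gz) - (quad Q q w + gw) \<le> (y - z - \<gamma> *\<^sub>R (Q *v (y - z))) \<bullet> (z - w) / \<gamma>"
proof -
  have minorant: "ereal (m - norm q * norm w - lambda_max Q / 2 * (norm w)\<^sup>2) \<le> g w" for w
    using quad_upper_bound[OF Q, of q w] by (intro order_trans[OF _ bound[of w]]) simp
  have min: "g z + ereal (1 / (2 * \<gamma>) * (norm (z - (2 *\<^sub>R y - u)))\<^sup>2)
      \<le> g w + ereal (1 / (2 * \<gamma>) * (norm (w - (2 *\<^sub>R y - u)))\<^sup>2)" for w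
    unfolding z by (rule prox_is_minimizer[OF g(1,2) \<gamma>(1) minorant])
      (use \<gamma> lambda_max_nonneg[OF Q] in auto)
  obtain gz where gz: "g z = ereal gz" and
    sub: "\<And>w gw. g w = ereal gw \<Longrightarrow> gz + ((2 *\<^sub>R y - u - z) \<bullet> (w - z)) / \<gamma> \<le> gw"
    by (rule prox_minimizer_subgradient[OF g(1,3) \<gamma>(1) min]) (rule that; blast)
  have u: "u = y + \<gamma> *\<^sub>R (Q *v y + q)" using prox_quad[OF Q \<gamma>(1), of q u] by (simp add: y)
  have "(quad Q q z + gz) - (quad Q q w + gw)
      \<le> (y - z - \<gamma> *\<^sub>R (Q *v (y - z))) \<bullet> (z - w) / \<gamma>" if "g w = ereal gw" for w gw
  proof -
    have "(2 *\<^sub>R y - u - z) \<bullet> (w - z) / \<gamma> + (Q *v z + q) \<bullet> (w - z)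
        = - ((y - z - \<gamma> *\<^sub>R (Q *v (y - z))) \<bullet> (z - w) / \<gamma>)"
      unfolding u scaleR_2 using \<gamma>(1)
      by (simp add: matrix_vector_mult_diff_distrib inner_diff_left inner_diff_right
          inner_add_left field_simps)
    then show ?thesis using sub[OF that] quad_above_tangent[OF Q, of q z w] by linarith
  qed
  with gz show thesis by (rule that)
qed

section \<open>The metric of the iteration\<close>

text \<open>The form of \<open>(1 - \<gamma> Q) (1 + \<gamma> Q)\<close>: the factor \<open>1 - \<gamma> Q\<close> comes from the subgradient at \<open>z\<close>, and
  \<open>1 + \<gamma> Q\<close> converts displacements of \<open>prox\<^sub>\<gamma>\<^sub>f(x)\<close> into displacements of \<open>x\<close>.\<close>

definition dr_form :: "real \<Rightarrow> real^'n^'n \<Rightarrow> real^'n \<Rightarrow> real^'n \<Rightarrow> real" where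
  "dr_form \<gamma> Q a b = a \<bullet> b - \<gamma>\<^sup>2 * ((Q *v a) \<bullet> (Q *v b))"

lemma dr_form_semi_inner:
  fixes Q :: "real^'n^'n"
  assumes "symmetric_psd Q" "0 \<le> \<gamma>" "\<gamma> * lambda_max Q \<le> 1"
  shows "semi_inner (dr_form \<gamma> Q)"
proof
  show "bilinear (dr_form \<gamma> Q)"
    unfolding bilinear_def
    by (auto intro!: linearI simp: dr_form_def matrix_vector_right_distrib matrix_vector_mult_scaleR
        inner_add_left inner_add_right algebra_simps)
  show "dr_form \<gamma> Q a b = dr_form \<gamma> Q b a" for a b
    by (simp add: dr_form_def inner_commute)
  show "0 \<le> dr_form \<gamma> Q a a" for a
    using psd_square_bounds(1)[OF assms, of a] by (simp add: dr_form_def power2_norm_eq_inner)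
qed

lemma dr_form_self_adjoint:
  fixes Q :: "real^'n^'n"
  assumes "transpose Q = Q"
  shows "dr_form \<gamma> Q a (Q *v b) = dr_form \<gamma> Q b (Q *v a)"
  using symmetric_inner[OF assms, of a b] symmetric_inner[OF assms, of "Q *v a" "Q *v b"]
  by (simp add: dr_form_def inner_commute)

lemma dr_form_Q_nonneg:
  fixes Q :: "real^'n^'n"
  assumes "symmetric_psd Q" "0 \<le> \<gamma>" "\<gamma> * lambda_max Q \<le> 1"
  shows "0 \<le> dr_form \<gamma> Q a (Q *v a)"
  using psd_square_bounds(2)[OF assms, of a] by (simp add: dr_form_def)

text \<open>The right-hand side is the squared distance between two points whose proximal points for the
  quadratic differ by \<open>a\<close>.\<close>

lemma dr_form_le_norm:
  fixes Q :: "real^'n^'n"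
  assumes "symmetric_psd Q" "0 \<le> \<gamma>"
  shows "dr_form \<gamma> Q a a \<le> (norm (a + \<gamma> *\<^sub>R (Q *v a)))\<^sup>2"
proof -
  have "(norm (a + \<gamma> *\<^sub>R (Q *v a)))\<^sup>2 - dr_form \<gamma> Q a a
      = 2 * \<gamma> * (a \<bullet> (Q *v a)) + 2 * (\<gamma>\<^sup>2 * (norm (Q *v a))\<^sup>2)"
    unfolding dr_form_def power2_norm_eq_inner
    by (simp add: inner_add_left inner_add_right inner_commute[of "Q *v a" a] power2_eq_square
        algebra_simps)
  moreover have "0 \<le> \<dots>" using assms by (simp add: symmetric_psd_def)
  ultimately show ?thesis by linarith
qed

section \<open>The convergence rate\<close>

theorem theorem5:
  fixes Q :: "real^'n^'n" and q :: "real^'n"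
    and f F g :: "real^'n \<Rightarrow> ereal"
    and Lf \<gamma> lam :: real
    and lams \<beta> :: "nat \<Rightarrow> real"
    and Fstar :: ereal
    and x u y z :: "nat \<Rightarrow> real^'n"
  assumes Q: "symmetric_psd Q"
    and f: "f = (\<lambda>v. ereal (quad Q q v))"
    and Lf: "Lf = lambda_max Q"
    and g: "proper_fun g" "closed_fun g" "convex_fun g"
    and F: "F = (\<lambda>v. f v + g v)"
    and minimizers: "minimizers F \<noteq> {}"
    and Fstar: "Fstar = (INF v. F v)"
    and gamma: "0 < \<gamma>" "ereal \<gamma> < 1 / ereal Lf"  (* in ereal, 1 / 0 = \<infinity> *)
    and lam: "lam = (1 - \<gamma> * Lf) / (1 + \<gamma> * Lf)"
    and lams: "\<And>k. lams k = lam"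
    and beta: "\<And>k. \<beta> k = (if k = 0 then 0 else (real k - 1) / (real k + 2))"
    and init: "u 0 = x 0"
    and y: "\<And>k. y k = prox \<gamma> f (u k)"
    and z: "\<And>k. z k = prox \<gamma> g (2 *\<^sub>R y k - u k)"
    and x: "\<And>k. x (Suc k) = u k + lams k *\<^sub>R (z k - y k)"
    and u: "\<And>k. u (Suc k) = x (Suc k) + \<beta> k *\<^sub>R (x (Suc k) - x k)"
  shows "\<forall>xt \<in> dr_fixpoints \<gamma> f g. \<forall>k.
    F (z k) - Fstar \<le> ereal (2 / (\<gamma> * lam * (real k + 2)\<^sup>2) * (norm (x 0 - xt))\<^sup>2)"
proof (intro ballI allI)
  fix xt k assume xt: "xt \<in> dr_fixpoints \<gamma> f g"
  have symQ: "transpose Q = Q" using Q by (simp add: symmetric_psd_def)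
  have L0: "0 \<le> Lf" using lambda_max_nonneg[OF Q] by (simp add: Lf)
  have gL: "\<gamma> * Lf < 1"
  proof (cases "Lf = 0")
    case False
    then have "\<gamma> < 1 / Lf" using gamma(2) L0 by (simp add: one_ereal_def)
    then show ?thesis using False L0 by (simp add: field_simps)
  qed simp
  have gL': "0 \<le> \<gamma>" "\<gamma> * lambda_max Q \<le> 1" "\<gamma> * lambda_max Q < 1"
    using gL gamma Lf by simp_all
  have lam1: "0 < lam" "1 \<le> 1 / lam"
    using gL gamma(1) L0 by (auto simp: lam add_pos_nonneg le_divide_eq)

  obtain xs where xs: "\<And>v. F xs \<le> F v" using minimizers by (auto simp: minimizers_def)
  obtain v0 where "g v0 \<noteq> \<infinity>" using g(1) by (auto simp: proper_fun_def)
  then have "F v0 \<noteq> \<infinity>" by (simp add: F f)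
  then have "F xs \<noteq> \<infinity>" using xs[of v0] by auto
  moreover have "F xs \<noteq> -\<infinity>" using g(1) by (simp add: F f proper_fun_def)
  ultimately obtain m where "F xs = ereal m" by (cases "F xs") auto
  then have bound: "ereal (m - quad Q q w) \<le> g w" for w
    using xs[of w] by (cases "g w") (auto simp: F f)

  note step = dr_step_inequality[OF Q gamma(1) gL'(3) g bound, folded f]

  \<comment> \<open>At a fixed point the step vanishes, so the step inequality says that \<open>w\<close> minimizes \<open>F\<close>.\<close>
  define w where "w = prox \<gamma> f xt"
  have "w = prox \<gamma> g (2 *\<^sub>R w - xt)" using xt by (simp add: dr_fixpoints_def w_def)
  from step[OF w_def this] obtain gw where gw: "g w = ereal gw" and
    w_min: "\<And>v gv. g v = ereal gv \<Longrightarrow> quad Q q w + gw \<le> quad Q q v + gv"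
    by (auto simp: diff_le_eq)
  define Fs where "Fs = quad Q q w + gw"
  have "ereal Fs \<le> F v" for v
    using w_min[of v] g(1) by (cases "g v") (auto simp: F f Fs_def proper_fun_def)
  moreover have "F w = ereal Fs" by (simp add: F f Fs_def gw)
  ultimately have Fstar': "Fstar = ereal Fs"
    unfolding Fstar by (metis INF_lower INF_greatest UNIV_I order_antisym)

  have "\<exists>gz. g (z k) = ereal gz \<and> (\<forall>w gw. g w = ereal gw \<longrightarrow>
      (quad Q q (z k) + gz) - (quad Q q w + gw)
        \<le> (y k - z k - \<gamma> *\<^sub>R (Q *v (y k - z k))) \<bullet> (z k - w) / \<gamma>)" for k
    using step[OF y z] by (metis (no_types, lifting))
  then obtain gz where gz: "\<And>k. g (z k) = ereal (gz k)"
    and z_step: "\<And>k w gw. g w = ereal gw \<Longrightarrow>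
      (quad Q q (z k) + gz k) - (quad Q q w + gw)
        \<le> (y k - z k - \<gamma> *\<^sub>R (Q *v (y k - z k))) \<bullet> (z k - w) / \<gamma>"
    by metis
  define \<Phi> where "\<Phi> k = quad Q q (z k) + gz k" for k

  \<comment> \<open>All iterates are pulled back by the affine map \<open>prox \<gamma> f\<close>, which respects the extrapolation.\<close>
  define X where "X k = prox \<gamma> f (x k)" for k
  have prox_f: "prox \<gamma> f v + \<gamma> *\<^sub>R (Q *v prox \<gamma> f v + q) = v" for v
    unfolding f by (rule prox_quad[OF Q gamma(1)])
  have x_X: "x k = X k + \<gamma> *\<^sub>R (Q *v X k + q)" for k
    by (simp add: X_def prox_f)
  have y0: "y 0 = X 0" by (simp add: y X_def init)
  have y_Suc: "y (Suc k) = X (Suc k) + \<beta> k *\<^sub>R (X (Suc k) - X k)" for k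
    unfolding y f
  proof (rule prox_quad_eqI[OF Q gamma(1)])
    show "X (Suc k) + \<beta> k *\<^sub>R (X (Suc k) - X k)
        + \<gamma> *\<^sub>R (Q *v (X (Suc k) + \<beta> k *\<^sub>R (X (Suc k) - X k)) + q) = u (Suc k)"
      unfolding u x_X
      by (simp add: matrix_vector_right_distrib matrix_vector_mult_diff_distrib
          matrix_vector_mult_scaleR algebra_simps)
  qed

  define h where "h k = y k - X (Suc k)" for k
  \<comment> \<open>The part of the displacement \<open>y k - z k\<close> that the relaxed step leaves out. It is nonnegative in the
    metric because \<open>lam \<le> 1\<close>.\<close>
  define C where "C a = (1 / lam) *\<^sub>R (a + \<gamma> *\<^sub>R (Q *v a)) - a" for a
  have h: "h k + \<gamma> *\<^sub>R (Q *v h k) = lam *\<^sub>R (y k - z k)" for k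
  proof -
    have "h k + \<gamma> *\<^sub>R (Q *v h k)
        = (y k + \<gamma> *\<^sub>R (Q *v y k + q)) - (X (Suc k) + \<gamma> *\<^sub>R (Q *v X (Suc k) + q))"
      by (simp add: h_def matrix_vector_mult_diff_distrib algebra_simps)
    also have "\<dots> = u k - x (Suc k)"
      unfolding x_X[symmetric] y prox_f ..
    also have "\<dots> = lam *\<^sub>R (y k - z k)"
      by (simp add: x lams algebra_simps)
    finally show ?thesis .
  qed
  have yz: "y k - z k = (1 / lam) *\<^sub>R (h k + \<gamma> *\<^sub>R (Q *v h k))" for k
    unfolding h using lam1 by simp
  have z_eq: "z k = X (Suc k) - C (h k)" for k
    using yz[of k] by (simp add: C_def h_def algebra_simps)

  interpret semi_inner "dr_form \<gamma> Q"
    by (rule dr_form_semi_inner[OF Q gL'(1,2)])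
  have C_lin: "C (a - b) = C a - C b" for a b
    by (simp add: C_def matrix_vector_mult_diff_distrib algebra_simps)
  have form_C: "dr_form \<gamma> Q a (C b) = (1 / lam - 1) * dr_form \<gamma> Q a b
      + \<gamma> / lam * dr_form \<gamma> Q a (Q *v b)" for a b
    by (simp add: C_def expand algebra_simps)
  have C_sym: "dr_form \<gamma> Q a (C b) = dr_form \<gamma> Q b (C a)" for a b
    using dr_form_self_adjoint[OF symQ, of \<gamma> a b] sym[of a b] unfolding form_C by simp
  have C_psd: "0 \<le> dr_form \<gamma> Q a (C a)" for a
    using psd[of a] dr_form_Q_nonneg[OF Q gL'(1,2), of a] lam1 gamma(1) unfolding form_C by simp
  have value_step: "\<gamma> * lam * (\<Phi> k - (quad Q q v + gv)) \<le> dr_form \<gamma> Q (h k) (z k - v)"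
    if "g v = ereal gv" for k v gv
  proof -
    have "(y k - z k - \<gamma> *\<^sub>R (Q *v (y k - z k))) \<bullet> a = dr_form \<gamma> Q (h k) a / lam" for a
      unfolding yz using symmetric_inner[OF symQ, of "Q *v h k" a]
      by (simp add: dr_form_def matrix_vector_right_distrib matrix_vector_mult_scaleR
          inner_add_left inner_diff_left algebra_simps power2_eq_square diff_divide_distrib)
    then have "\<Phi> k - (quad Q q v + gv) \<le> dr_form \<gamma> Q (h k) (z k - v) / (lam * \<gamma>)"
      using z_step[OF that, of k] by (simp add: \<Phi>_def)
    then show ?thesis using lam1 gamma(1) by (simp add: pos_le_divide_eq mult.commute)
  qed

  \<comment> \<open>The gap is measured at \<open>z k\<close>, but the inequality for the proximal point method needs it at
    \<open>X (Suc k)\<close>. The second term makes up the difference: in two consecutive steps the mixed product of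
    the two remainders is dominated by the halves of their squares, which telescope.\<close>
  define \<delta> where "\<delta> k = \<gamma> * lam * (\<Phi> k - Fs) + dr_form \<gamma> Q (h k) (C (h k)) / 2" for k
  have gap_nonneg: "0 \<le> \<gamma> * lam * (\<Phi> k - Fs)" for k
    using w_min[OF gz[of k]] lam1 gamma(1) by (simp add: \<Phi>_def Fs_def)
  have "\<delta> k \<le> 2 / (real k + 2)\<^sup>2 * dr_form \<gamma> Q (X 0 - w) (X 0 - w)"
  proof (rule accelerated_proximal_point_rate)
    show "y 0 = X 0" by (rule y0)
    show "y (Suc k) = X (Suc k)
        + (if k = 0 then 0 else (real k - 1) / (real k + 2)) *\<^sub>R (X (Suc k) - X k)" for k
      by (simp only: y_Suc beta)
    show "0 \<le> \<delta> k" for k using gap_nonneg[of k] C_psd[of "h k"] by (simp add: \<delta>_def)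
    show "\<delta> k \<le> dr_form \<gamma> Q (y k - X (Suc k)) (X (Suc k) - w)" for k
    proof -
      have "z k - w = (X (Suc k) - w) - C (h k)" by (simp add: z_eq)
      then have "\<gamma> * lam * (\<Phi> k - Fs)
          \<le> dr_form \<gamma> Q (h k) (X (Suc k) - w) - dr_form \<gamma> Q (h k) (C (h k))"
        using value_step[OF gw, of k] by (simp add: Fs_def expand)
      then show ?thesis using C_psd[of "h k"] by (simp add: \<delta>_def h_def)
    qed
    show "\<delta> (Suc k) - \<delta> k
        \<le> dr_form \<gamma> Q (y (Suc k) - X (Suc (Suc k))) (X (Suc (Suc k)) - X (Suc k))" for k
    proof -
      let ?a = "h (Suc k)" and ?b = "h k"
      have zz: "z (Suc k) - z k = (X (Suc (Suc k)) - X (Suc k)) - C ?a + C ?b" by (simp add: z_eq)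
      have "\<gamma> * lam * (\<Phi> (Suc k) - \<Phi> k) \<le> dr_form \<gamma> Q ?a (z (Suc k) - z k)"
        using value_step[OF gz[of k], of "Suc k"] by (simp add: \<Phi>_def)
      also have "\<dots> = dr_form \<gamma> Q ?a (X (Suc (Suc k)) - X (Suc k)) - dr_form \<gamma> Q ?a (C ?a)
          + dr_form \<gamma> Q ?a (C ?b)"
        unfolding zz by (simp add: expand)
      finally have 1: "\<gamma> * lam * (\<Phi> (Suc k) - \<Phi> k)
          \<le> dr_form \<gamma> Q ?a (X (Suc (Suc k)) - X (Suc k))
          - dr_form \<gamma> Q ?a (C ?a) + dr_form \<gamma> Q ?a (C ?b)" .
      have "0 \<le> dr_form \<gamma> Q ?a (C ?a) - 2 * dr_form \<gamma> Q ?a (C ?b) + dr_form \<gamma> Q ?b (C ?b)"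
        using C_psd[of "?a - ?b"] C_sym[of ?b ?a] by (simp add: C_lin expand)
      moreover have "\<delta> (Suc k) - \<delta> k = \<gamma> * lam * (\<Phi> (Suc k) - \<Phi> k)
          + dr_form \<gamma> Q ?a (C ?a) / 2 - dr_form \<gamma> Q ?b (C ?b) / 2"
        by (simp add: \<delta>_def algebra_simps)
      ultimately show ?thesis using 1 by (simp add: h_def[symmetric])
    qed
  qed
  also have "dr_form \<gamma> Q (X 0 - w) (X 0 - w) \<le> (norm (x 0 - xt))\<^sup>2"
  proof -
    have "x 0 - xt = (X 0 - w) + \<gamma> *\<^sub>R (Q *v (X 0 - w))"
      using x_X[of 0] prox_f[of xt, folded w_def]
      by (simp add: matrix_vector_mult_diff_distrib algebra_simps)
    then show ?thesis using dr_form_le_norm[OF Q gL'(1)] by metis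
  qed
  finally have "\<gamma> * lam * (\<Phi> k - Fs) \<le> 2 / (real k + 2)\<^sup>2 * (norm (x 0 - xt))\<^sup>2"
    using C_psd[of "h k"] by (simp add: \<delta>_def divide_right_mono mult_left_mono)
  then have "\<Phi> k - Fs \<le> 2 / (\<gamma> * lam * (real k + 2)\<^sup>2) * (norm (x 0 - xt))\<^sup>2"
    using lam1 gamma(1) by (simp add: field_simps)
  then show "F (z k) - Fstar \<le> ereal (2 / (\<gamma> * lam * (real k + 2)\<^sup>2) * (norm (x 0 - xt))\<^sup>2)"
    by (simp add: Fstar' F f gz \<Phi>_def)
qed

end
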